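(* Let $\alpha\in\mathbb{C}$ with $|\alpha|<1$, and let $\theta$ be a real number with $-\pi<\theta\le\pi$ and $|\theta|=\frac{2\pi q}{p}$ for integers $p\ge 1$, $q\ge 0$. Let $X^2_{\alpha,\theta}$ be the set of sums determined by all signed revolving sequences with parameter $\theta$ (see context). Let $K^2_{\alpha,\theta}\subset\mathbb{C}$ be the self-similar set generated by the iterated function system $$\psi_1(z)=\alpha\overline{z},\qquad \psi_2(z)=(\alpha e^{i\theta})\overline{z}+\alpha,$$ i.e. the unique nonempty compact set with $K^2_{\alpha,\theta}=\psi_1(K^2_{\alpha,\theta})\cup\psi_2(K^2_{\alpha,\theta})$. Then $$\bigcup_{k=0}^{p-1}(e^{i\theta})^k K^2_{\alpha,\theta}=X^2_{\alpha,\theta}.$$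
   Context: $\mathbb{N}=\{1,2,3,\dots\}$. For $p,\theta$ as in the claim put $\Delta_\theta:=\{0,1,e^{i\theta},e^{2i\theta},\dots,e^{(p-1)i\theta}\}$. A sequence $(\delta_1,\delta_2,\dots)\in\Delta_\theta^{\mathbb{N}}$ satisfies the Signed Revolving Condition (SRC) if: (1) $\delta_1\in\Delta_\theta$ is free to choose; (2) if $\delta_1=\dots=\delta_k=0$, then $\delta_{k+1}\in\Delta_\theta$ is free to choose; (3) otherwise, with $j_0(k):=\max\{j\le k:\delta_j\neq 0\}$, either $\delta_{k+1}=0$, or $\delta_{k+1}=e^{i\theta}\delta_{j_0(k)}$ if $j_0(k)$ is odd, and $\delta_{k+1}=e^{-i\theta}\delta_{j_0(k)}$ if $j_0(k)$ is even. Let $W^{\pm}_\theta$ be the set of all sequences in $\Delta_\theta^{\mathbb{N}}$ satisfying the SRC. Put $\eta_1=\alpha$ and $\eta_{j+1}=\overline{\eta_j}$ for $j\ge 1$, and $$X^2_{\alpha,\theta}:=\left\{\sum_{n=1}^\infty\delta_n\prod_{j=1}^n\eta_j:(\delta_1,\delta_2,\dots)\in W^{\pm}_\theta\right\}.$$ For $c\in\mathbb{C}$ and $A\subset\mathbb{C}$, $cA:=\{ca:a\in A\}$. The superscript $2$ in $X^2,K^2$ is a label, not a power. *)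

theory Defs
  imports "HOL-Analysis.Analysis"
begin

definition Delta :: "nat \<Rightarrow> real \<Rightarrow> complex set" where
  "Delta p \<theta> = insert 0 {cis (real k * \<theta>) | k. k < p}"

text \<open>
  A sequence \<open>(\<delta>\<^sub>1, \<delta>\<^sub>2, \<dots>)\<close> is a function \<^typ>\<open>nat \<Rightarrow> complex\<close> of which only the
  values at positive arguments matter; nothing below reads or constrains \<open>\<delta> 0\<close>.
  Clauses (1) and (2) of the condition impose no restriction beyond membership in
  \<^const>\<open>Delta\<close>, so only clause (3) appears.
\<close>

definition last_nonzero :: "(nat \<Rightarrow> complex) \<Rightarrow> nat \<Rightarrow> nat" where
  "last_nonzero \<delta> k = Max {j \<in> {1..k}. \<delta> j \<noteq> 0}"

definition signed_revolving :: "real \<Rightarrow> (nat \<Rightarrow> complex) \<Rightarrow> bool" where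
  "signed_revolving \<theta> \<delta> \<longleftrightarrow>
    (\<forall>k\<ge>1. (\<exists>j\<in>{1..k}. \<delta> j \<noteq> 0) \<longrightarrow>
      \<delta> (k + 1) = 0 \<or>
      (if odd (last_nonzero \<delta> k)
       then \<delta> (k + 1) = cis \<theta> * \<delta> (last_nonzero \<delta> k)
       else \<delta> (k + 1) = cis (- \<theta>) * \<delta> (last_nonzero \<delta> k)))"

definition W_signed :: "nat \<Rightarrow> real \<Rightarrow> (nat \<Rightarrow> complex) set" where
  "W_signed p \<theta> = {\<delta> \<in> {1..} \<rightarrow> Delta p \<theta>. signed_revolving \<theta> \<delta>}"

text \<open>The sequence \<open>\<eta>\<close> starts at index 1; the value at 0 is a dummy.\<close>

fun eta :: "complex \<Rightarrow> nat \<Rightarrow> complex" where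
  "eta \<alpha> 0 = 0"
| "eta \<alpha> (Suc 0) = \<alpha>"
| "eta \<alpha> (Suc (Suc j)) = cnj (eta \<alpha> (Suc j))"

text \<open>
  \<^const>\<open>suminf\<close> counts from 0, hence the shift to \<open>Suc n\<close>. The series converge absolutely
  for \<open>norm \<alpha> < 1\<close>, as \<^const>\<open>Delta\<close> lies in the closed unit disc.
\<close>

definition X2 :: "nat \<Rightarrow> complex \<Rightarrow> real \<Rightarrow> complex set" where
  "X2 p \<alpha> \<theta> =
    {(\<Sum>n. \<delta> (Suc n) * (\<Prod>j=1..Suc n. eta \<alpha> j)) | \<delta>. \<delta> \<in> W_signed p \<theta>}"

definition psi1 :: "complex \<Rightarrow> complex \<Rightarrow> complex" where
  "psi1 \<alpha> z = \<alpha> * cnj z"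

definition psi2 :: "complex \<Rightarrow> real \<Rightarrow> complex \<Rightarrow> complex" where
  "psi2 \<alpha> \<theta> z = (\<alpha> * cis \<theta>) * cnj z + \<alpha>"

text \<open>
  For \<open>norm \<alpha> < 1\<close> both maps are contractions, so by Hutchinson's theorem exactly one set
  satisfies the description.
\<close>

definition K2 :: "complex \<Rightarrow> real \<Rightarrow> complex set" where
  "K2 \<alpha> \<theta> =
    (THE K. K \<noteq> {} \<and> compact K \<and> K = psi1 \<alpha> ` K \<union> psi2 \<alpha> \<theta> ` K)"

end

theory Submission
  imports Defs
begin

text \<open>
  Write \<open>u = cis \<theta>\<close>. Both maps have the form \<open>z \<mapsto> \<alpha> * b + \<alpha> * u ^ b * cnj z\<close> with a bit
  \<open>b\<close>. Composing the maps selected by a bit sequence \<open>\<omega>\<close> therefore produces a series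
  whose \<open>n\<close>-th weight is a product of alternating factors \<open>\<alpha>\<close> and \<open>cnj \<alpha>\<close>, and whose \<open>n\<close>-th
  coefficient is \<open>0\<close> if \<open>\<omega> n\<close> is unset and otherwise the product of the factors \<open>u\<close> or
  \<open>cnj u\<close> contributed by the earlier set bits. Since every map conjugates its argument, a set bit
  contributes \<open>u\<close> or \<open>cnj u\<close> according to the parity of its position. This
  is exactly the revolving rule: passing from one nonzero digit to the next multiplies by the
  single factor that the former contributes (\<open>phase_jump\<close>).

  The limits \<open>address \<alpha> \<theta> \<omega>\<close> form the attractor. A bounded set covered by its two images
  consists of addresses: backward orbits stay bounded, so the error in comparing a point with the
  address of its itinerary is contracted to zero (\<open>subset_range_address\<close>). A nonempty closed set
  containing its images contains every address, because forward orbits converge to addresses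
  (\<open>range_address_subset\<close>). The first of these, applied to the closure of the set of
  addresses, also shows that this set is closed, hence compact (\<open>closed_range_address\<close>).

  The digits of addresses are precisely the revolving sequences whose first nonzero digit, if
  there is one, is \<open>1\<close>. A
  revolving sequence is determined by its zero set and its first nonzero digit, so a rotation by
  a power of \<open>u\<close> gives all of them; the relation \<open>u ^ p = 1\<close> keeps the digits among the \<open>p\<close>
  admissible powers.
\<close>

section \<open>Digits of an address\<close>

text \<open>Positions count from \<open>0\<close> here, so even \<open>j\<close> corresponds to the odd place \<open>Suc j\<close> of a
  revolving sequence.\<close>

definition turn :: "real \<Rightarrow> nat \<Rightarrow> complex" where
  "turn \<theta> j = (if even j then cis \<theta> else cis (- \<theta>))"

definition phase :: "real \<Rightarrow> (nat \<Rightarrow> bool) \<Rightarrow> nat \<Rightarrow> complex" where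
  "phase \<theta> \<omega> n = (\<Prod>j<n. if \<omega> j then turn \<theta> j else 1)"

definition digit :: "real \<Rightarrow> (nat \<Rightarrow> bool) \<Rightarrow> nat \<Rightarrow> complex" where
  "digit \<theta> \<omega> n = (if \<omega> n then phase \<theta> \<omega> n else 0)"

definition weight :: "complex \<Rightarrow> nat \<Rightarrow> complex" where
  "weight \<alpha> n = (\<Prod>j=1..n. eta \<alpha> j)"

definition address :: "complex \<Rightarrow> real \<Rightarrow> (nat \<Rightarrow> bool) \<Rightarrow> complex" where
  "address \<alpha> \<theta> \<omega> = (\<Sum>n. digit \<theta> \<omega> n * weight \<alpha> (Suc n))"

definition branch :: "complex \<Rightarrow> real \<Rightarrow> bool \<Rightarrow> complex \<Rightarrow> complex" where
  "branch \<alpha> \<theta> b = (if b then psi2 \<alpha> \<theta> else psi1 \<alpha>)"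

lemma turn_Suc: "turn \<theta> (Suc j) = cnj (turn \<theta> j)"
  by (simp add: turn_def cis_cnj)

lemma norm_phase [simp]: "norm (phase \<theta> \<omega> n) = 1"
proof -
  have "norm (phase \<theta> \<omega> n) = (\<Prod>j<n. 1)"
    unfolding phase_def prod_norm [symmetric] by (rule prod.cong) (auto simp: turn_def)
  then show ?thesis by simp
qed

lemma phase_nonzero [simp]: "phase \<theta> \<omega> n \<noteq> 0"
  using norm_phase [of \<theta> \<omega> n] by (metis norm_zero zero_neq_one)

lemma norm_digit_le: "norm (digit \<theta> \<omega> n) \<le> 1"
  by (simp add: digit_def)

lemma digit_eq_0_iff [simp]: "digit \<theta> \<omega> n = 0 \<longleftrightarrow> \<not> \<omega> n"
  by (simp add: digit_def)

text \<open>Removing the first bit changes the parity of the position of every later one and so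
  conjugates its turn. This matches the conjugation in the map that the first bit selects.\<close>

lemma phase_shift:
  "phase \<theta> \<omega> (Suc n) = (if \<omega> 0 then cis \<theta> else 1) * cnj (phase \<theta> (\<omega> \<circ> Suc) n)"
proof -
  have "phase \<theta> \<omega> (Suc n)
      = (if \<omega> 0 then turn \<theta> 0 else 1) * (\<Prod>j<n. if \<omega> (Suc j) then turn \<theta> (Suc j) else 1)"
    unfolding phase_def by (rule prod.lessThan_Suc_shift)
  also have "(\<Prod>j<n. if \<omega> (Suc j) then turn \<theta> (Suc j) else 1) = cnj (phase \<theta> (\<omega> \<circ> Suc) n)"
    unfolding phase_def cnj_prod by (rule prod.cong) (auto simp: turn_Suc)
  finally show ?thesis by (simp add: turn_def)
qed

lemma digit_shift:
  "digit \<theta> \<omega> (Suc n) = (if \<omega> 0 then cis \<theta> else 1) * cnj (digit \<theta> (\<omega> \<circ> Suc) n)"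
  by (simp add: digit_def phase_shift)

lemma digit_0: "digit \<theta> \<omega> 0 = (if \<omega> 0 then 1 else 0)"
  by (simp add: digit_def phase_def)

text \<open>Unset bits contribute no factor, so between consecutive set bits the phase changes only by
  the turn of the earlier one.\<close>

lemma phase_jump:
  assumes "j < n" "\<omega> j" "\<And>i. j < i \<Longrightarrow> i < n \<Longrightarrow> \<not> \<omega> i"
  shows "phase \<theta> \<omega> n = turn \<theta> j * phase \<theta> \<omega> j"
  using assms
proof (induction n)
  case (Suc n)
  show ?case
  proof (cases "j = n")
    case True
    then show ?thesis using Suc.prems by (simp add: phase_def)
  next
    case False
    then have "phase \<theta> \<omega> n = turn \<theta> j * phase \<theta> \<omega> j" "\<not> \<omega> n"
      using Suc by auto
    then show ?thesis by (simp add: phase_def)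
  qed
qed simp

lemma phase_eq_1:
  assumes "\<And>i. i < n \<Longrightarrow> \<not> \<omega> i"
  shows "phase \<theta> \<omega> n = 1"
  unfolding phase_def by (rule prod.neutral) (use assms in auto)

lemma weight_Suc: "weight \<alpha> (Suc n) = \<alpha> * cnj (weight \<alpha> n)"
proof -
  have "weight \<alpha> (Suc n) = eta \<alpha> 1 * (\<Prod>j=1..n. eta \<alpha> (Suc j))"
    unfolding weight_def
    by (metis One_nat_def prod.atLeast_Suc_atMost prod.shift_bounds_cl_Suc_ivl le_add1 plus_1_eq_Suc)
  also have "(\<Prod>j=1..n. eta \<alpha> (Suc j)) = cnj (weight \<alpha> n)"
    unfolding weight_def cnj_prod
  proof (rule prod.cong)
    fix j assume "j \<in> {1..n}"
    then show "eta \<alpha> (Suc j) = cnj (eta \<alpha> j)" by (cases j) auto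
  qed simp
  finally show ?thesis by simp
qed

lemma norm_weight: "norm (weight \<alpha> n) = norm \<alpha> ^ n"
  by (induction n) (simp add: weight_def, simp add: weight_Suc norm_mult)

section \<open>The attractor as the set of addresses\<close>

lemma norm_address_term_le:
  "norm (digit \<theta> \<omega> n * weight \<alpha> (Suc n)) \<le> norm \<alpha> ^ Suc n"
  unfolding norm_mult norm_weight
  using mult_right_mono [OF norm_digit_le, of "norm \<alpha> ^ Suc n"] by simp

lemma summable_norm_power_Suc:
  fixes \<alpha> :: complex
  assumes "norm \<alpha> < 1"
  shows "summable (\<lambda>n. norm \<alpha> ^ Suc n)"
  using assms by (simp add: summable_mult summable_geometric)

lemma summable_address:
  assumes "norm \<alpha> < 1"
  shows "summable (\<lambda>n. digit \<theta> \<omega> n * weight \<alpha> (Suc n))"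
  by (rule summable_comparison_test' [OF summable_norm_power_Suc [OF assms] norm_address_term_le])

lemma bounded_range_address:
  assumes "norm \<alpha> < 1"
  shows "bounded (range (address \<alpha> \<theta>))"
proof -
  have "norm (address \<alpha> \<theta> \<omega>) \<le> (\<Sum>n. norm \<alpha> ^ Suc n)" for \<omega>
    unfolding address_def
    by (rule norm_suminf_le [OF norm_address_term_le summable_norm_power_Suc [OF assms]])
  then show ?thesis unfolding bounded_iff by blast
qed

text \<open>The self-similarity of the coding: the first bit selects the outermost map.\<close>

lemma address_shift:
  assumes "norm \<alpha> < 1"
  shows "address \<alpha> \<theta> \<omega> = branch \<alpha> \<theta> (\<omega> 0) (address \<alpha> \<theta> (\<omega> \<circ> Suc))"
proof -
  let ?c = "if \<omega> 0 then cis \<theta> else 1"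
  let ?f = "\<lambda>\<omega> n. digit \<theta> \<omega> n * weight \<alpha> (Suc n)"
  have "?f \<omega> (Suc n) = (\<alpha> * ?c) * cnj (?f (\<omega> \<circ> Suc) n)" for n
    by (simp add: digit_shift weight_Suc [of _ "Suc n"] mult_ac)
  moreover have "(\<lambda>n. (\<alpha> * ?c) * cnj (?f (\<omega> \<circ> Suc) n))
      sums ((\<alpha> * ?c) * cnj (address \<alpha> \<theta> (\<omega> \<circ> Suc)))"
    unfolding address_def
    by (rule sums_mult, unfold sums_cnj, rule summable_sums, rule summable_address [OF assms])
  ultimately have "(\<lambda>n. ?f \<omega> (Suc n)) sums ((\<alpha> * ?c) * cnj (address \<alpha> \<theta> (\<omega> \<circ> Suc)))"
    by simp
  then have "?f \<omega> sums ((\<alpha> * ?c) * cnj (address \<alpha> \<theta> (\<omega> \<circ> Suc)) + ?f \<omega> 0)"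
    by (rule sums_Suc)
  then have "address \<alpha> \<theta> \<omega> = (\<alpha> * ?c) * cnj (address \<alpha> \<theta> (\<omega> \<circ> Suc)) + ?f \<omega> 0"
    unfolding address_def by (rule sums_unique [symmetric])
  then show ?thesis
    by (simp add: branch_def psi1_def psi2_def digit_0 weight_def)
qed

lemma dist_branch: "dist (branch \<alpha> \<theta> b z) (branch \<alpha> \<theta> b w) = norm \<alpha> * dist z w"
proof -
  have "branch \<alpha> \<theta> b z - branch \<alpha> \<theta> b w = \<alpha> * (if b then cis \<theta> else 1) * cnj (z - w)"
    by (simp add: branch_def psi1_def psi2_def algebra_simps)
  then show ?thesis unfolding dist_norm by (simp add: norm_mult del: complex_cnj_diff)
qed

lemma continuous_on_branch: "continuous_on S (branch \<alpha> \<theta> b)"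
  unfolding branch_def psi1_def [abs_def] psi2_def [abs_def]
  by (cases b; simp only: if_True if_False; intro continuous_intros)

lemma range_address_invariant:
  assumes "norm \<alpha> < 1"
  shows "range (address \<alpha> \<theta>) = (\<Union>b. branch \<alpha> \<theta> b ` range (address \<alpha> \<theta>))"
proof
  show "range (address \<alpha> \<theta>) \<subseteq> (\<Union>b. branch \<alpha> \<theta> b ` range (address \<alpha> \<theta>))"
  proof clarify
    fix \<omega>
    show "address \<alpha> \<theta> \<omega> \<in> (\<Union>b. branch \<alpha> \<theta> b ` range (address \<alpha> \<theta>))"
      by (subst address_shift [OF assms]) blast
  qed
  show "(\<Union>b. branch \<alpha> \<theta> b ` range (address \<alpha> \<theta>)) \<subseteq> range (address \<alpha> \<theta>)"
  proof clarify
    fix b \<omega>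
    have "address \<alpha> \<theta> (case_nat b \<omega>) = branch \<alpha> \<theta> b (address \<alpha> \<theta> \<omega>)"
      using address_shift [OF assms, of \<theta> "case_nat b \<omega>"] by (simp add: comp_def)
    then show "branch \<alpha> \<theta> b (address \<alpha> \<theta> \<omega>) \<in> range (address \<alpha> \<theta>)"
      using rangeI [of "address \<alpha> \<theta>" "case_nat b \<omega>"] by simp
  qed
qed

text \<open>Each point has a backward orbit in \<open>K\<close>. The point differs from the address of its itinerary
  by at most \<open>norm \<alpha> ^ n\<close> times the distance of the \<open>n\<close>-th orbit point from an address, and these
  distances are bounded.\<close>

lemma subset_range_address:
  assumes \<alpha>: "norm \<alpha> < 1" and "bounded K" and K: "K \<subseteq> (\<Union>b. branch \<alpha> \<theta> b ` K)"
  shows "K \<subseteq> range (address \<alpha> \<theta>)"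
proof
  fix z assume "z \<in> K"
  have "\<forall>x\<in>K. \<exists>b. \<exists>w. w \<in> K \<and> x = branch \<alpha> \<theta> b w"
    using K by blast
  from bchoice [OF this] obtain bit
    where "\<forall>x\<in>K. \<exists>w. w \<in> K \<and> x = branch \<alpha> \<theta> (bit x) w" ..
  from bchoice [OF this] obtain pre
    where pre: "\<forall>x\<in>K. pre x \<in> K \<and> x = branch \<alpha> \<theta> (bit x) (pre x)" ..
  define orb where "orb n = (pre ^^ n) z" for n
  define \<omega> where "\<omega> n = bit (orb n)" for n
  have orb: "orb n \<in> K" for n
  proof (induction n)
    case 0
    show ?case by (simp add: orb_def \<open>z \<in> K\<close>)
  next
    case (Suc n)
    then have "pre (orb n) \<in> K" using pre by blast
    then show ?case by (simp add: orb_def)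
  qed
  have step: "orb n = branch \<alpha> \<theta> (\<omega> n) (orb (Suc n))" for n
  proof -
    have "orb (Suc n) = pre (orb n)" by (simp add: orb_def)
    then show ?thesis unfolding \<omega>_def using pre orb [of n] by metis
  qed
  obtain B where B: "\<And>x y. x \<in> K \<Longrightarrow> y \<in> range (address \<alpha> \<theta>) \<Longrightarrow> dist x y \<le> B"
  proof -
    have "bounded (K \<union> range (address \<alpha> \<theta>))"
      using assms(2) bounded_range_address [OF \<alpha>] by simp
    then show ?thesis using that bounded_two_points [of "K \<union> range (address \<alpha> \<theta>)"] by blast
  qed
  define err where "err n = dist (orb n) (address \<alpha> \<theta> (\<lambda>i. \<omega> (i + n)))" for n
  have err: "err n = norm \<alpha> * err (Suc n)" for n
  proof -
    have "address \<alpha> \<theta> (\<lambda>i. \<omega> (i + n))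
        = branch \<alpha> \<theta> (\<omega> n) (address \<alpha> \<theta> (\<lambda>i. \<omega> (i + Suc n)))"
      by (subst address_shift [OF \<alpha>]) (simp add: comp_def)
    then show ?thesis
      unfolding err_def by (simp only: step [of n] dist_branch)
  qed
  have "err 0 = norm \<alpha> ^ n * err n" for n
  proof (induction n)
    case (Suc n)
    then have "err 0 = norm \<alpha> ^ n * (norm \<alpha> * err (Suc n))"
      by (simp only: err [of n])
    then show ?case by (simp only: power_Suc2 mult.assoc)
  qed simp
  moreover have "err n \<le> B" for n
    unfolding err_def using B orb by blast
  ultimately have le: "err 0 \<le> norm \<alpha> ^ n * B" for n
    by (metis mult_left_mono norm_ge_zero zero_le_power)
  have "(\<lambda>n. norm \<alpha> ^ n * B) \<longlonglongrightarrow> 0"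
    using \<alpha> by (intro tendsto_mult_left_zero LIMSEQ_power_zero) simp
  then have "err 0 \<le> 0"
    using le by (intro LIMSEQ_le_const) auto
  then have "z = address \<alpha> \<theta> \<omega>"
    by (simp add: err_def orb_def)
  then show "z \<in> range (address \<alpha> \<theta>)" by blast
qed

text \<open>Applying the first \<open>n\<close> maps of an itinerary to any point of \<open>K\<close> approximates the address
  with error of order \<open>norm \<alpha> ^ n\<close>.\<close>

lemma range_address_subset:
  assumes \<alpha>: "norm \<alpha> < 1" and "closed K" "K \<noteq> {}" and K: "(\<Union>b. branch \<alpha> \<theta> b ` K) \<subseteq> K"
  shows "range (address \<alpha> \<theta>) \<subseteq> K"
proof clarify
  fix \<omega>
  obtain z where z: "z \<in> K" using \<open>K \<noteq> {}\<close> by blast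
  obtain B where B: "\<And>\<omega>. dist z (address \<alpha> \<theta> \<omega>) \<le> B"
    using bounded_range_address [OF \<alpha>, of \<theta>]
    by (auto simp: bounded_any_center [of _ z])
  have ex: "\<exists>y\<in>K. dist y (address \<alpha> \<theta> \<omega>) \<le> norm \<alpha> ^ n * B" for n
  proof (induction n arbitrary: \<omega>)
    case 0
    then show ?case using z B by auto
  next
    case (Suc n)
    then obtain y where y: "y \<in> K" "dist y (address \<alpha> \<theta> (\<omega> \<circ> Suc)) \<le> norm \<alpha> ^ n * B"
      by blast
    have "dist (branch \<alpha> \<theta> (\<omega> 0) y) (address \<alpha> \<theta> \<omega>) \<le> norm \<alpha> ^ Suc n * B"
      using mult_left_mono [OF y(2), of "norm \<alpha>"]
      by (simp add: address_shift [OF \<alpha>, of \<theta> \<omega>] dist_branch mult_ac)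
    moreover have "branch \<alpha> \<theta> (\<omega> 0) y \<in> K" using K y(1) by blast
    ultimately show ?case by blast
  qed
  then obtain y where y: "\<And>n. y n \<in> K" "\<And>n. dist (y n) (address \<alpha> \<theta> \<omega>) \<le> norm \<alpha> ^ n * B"
    by metis
  have "(\<lambda>n. norm \<alpha> ^ n * B) \<longlonglongrightarrow> 0"
    using \<alpha> by (intro tendsto_mult_left_zero LIMSEQ_power_zero) simp
  then have "(\<lambda>n. dist (y n) (address \<alpha> \<theta> \<omega>)) \<longlonglongrightarrow> 0"
    by (rule tendsto_0_le [where K = 1]) (use y(2) in \<open>auto intro!: always_eventually order.trans [OF _ abs_ge_self]\<close>)
  then have "y \<longlonglongrightarrow> address \<alpha> \<theta> \<omega>"
    by (rule iffD2 [OF tendsto_dist_iff])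
  then show "address \<alpha> \<theta> \<omega> \<in> K"
    using closed_sequentially [OF \<open>closed K\<close>] y(1) by blast
qed

text \<open>The closure of the set of addresses is compact, so the two images of the closure form a
  closed set containing all addresses. Hence the closure is covered by its images and consists of
  addresses.\<close>

lemma closed_range_address:
  assumes \<alpha>: "norm \<alpha> < 1"
  shows "closed (range (address \<alpha> \<theta>))"
proof -
  let ?A = "range (address \<alpha> \<theta>)"
  have bdd: "bounded (closure ?A)"
    using bounded_range_address [OF \<alpha>] by (rule bounded_closure)
  then have "compact (branch \<alpha> \<theta> b ` closure ?A)" for b
    by (intro compact_continuous_image continuous_on_branch) (simp add: compact_eq_bounded_closed)
  then have "closed (\<Union>b. branch \<alpha> \<theta> b ` closure ?A)"
    by (intro closed_Union) (auto intro: compact_imp_closed)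
  moreover have "?A \<subseteq> (\<Union>b. branch \<alpha> \<theta> b ` closure ?A)"
    using range_address_invariant [OF \<alpha>, of \<theta>] closure_subset [of ?A] by blast
  ultimately have "closure ?A \<subseteq> (\<Union>b. branch \<alpha> \<theta> b ` closure ?A)"
    by (rule closure_minimal [rotated])
  then have "closure ?A \<subseteq> ?A"
    by (rule subset_range_address [OF \<alpha> bdd])
  then show ?thesis
    using closure_subset_eq by blast
qed

lemma K2_eq_range_address:
  assumes \<alpha>: "norm \<alpha> < 1"
  shows "K2 \<alpha> \<theta> = range (address \<alpha> \<theta>)"
proof -
  have union: "(\<Union>b. branch \<alpha> \<theta> b ` K) = psi1 \<alpha> ` K \<union> psi2 \<alpha> \<theta> ` K" for K
    by (auto simp: branch_def UNIV_bool)
  show ?thesis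
    unfolding K2_def union [symmetric]
  proof (rule the_equality, intro conjI)
    show "range (address \<alpha> \<theta>) \<noteq> {}" by simp
    show "compact (range (address \<alpha> \<theta>))"
      by (simp add: compact_eq_bounded_closed bounded_range_address closed_range_address \<alpha>)
    show "range (address \<alpha> \<theta>) = (\<Union>b. branch \<alpha> \<theta> b ` range (address \<alpha> \<theta>))"
      by (rule range_address_invariant [OF \<alpha>])
  next
    fix K assume K: "K \<noteq> {} \<and> compact K \<and> K = (\<Union>b. branch \<alpha> \<theta> b ` K)"
    then have "K \<subseteq> range (address \<alpha> \<theta>)"
      by (intro subset_range_address [OF \<alpha>]) (auto intro: compact_imp_bounded)
    moreover have "range (address \<alpha> \<theta>) \<subseteq> K"
      using K by (intro range_address_subset [OF \<alpha>]) (auto intro: compact_imp_closed)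
    ultimately show "K = range (address \<alpha> \<theta>)" by blast
  qed
qed

section \<open>Revolving sequences as rotated digit sequences\<close>

lemma last_nonzero_eq_Suc:
  assumes "\<exists>j\<in>{1..k}. \<delta> j \<noteq> 0"
  obtains j where "last_nonzero \<delta> k = Suc j" "j < k" "\<delta> (Suc j) \<noteq> 0"
    "\<And>i. j < i \<Longrightarrow> i < k \<Longrightarrow> \<delta> (Suc i) = 0"
proof -
  let ?S = "{j \<in> {1..k}. \<delta> j \<noteq> 0}"
  have "Max ?S \<in> ?S" using assms by (intro Max_in) auto
  then have L: "last_nonzero \<delta> k \<in> ?S" by (simp add: last_nonzero_def)
  then obtain j where j: "last_nonzero \<delta> k = Suc j"
    by (cases "last_nonzero \<delta> k") auto
  have "\<delta> (Suc i) = 0" if "j < i" "i < k" for i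
  proof (rule ccontr)
    assume "\<delta> (Suc i) \<noteq> 0"
    then have "Suc i \<le> Max ?S" using that by (intro Max_ge) auto
    then show False using j that by (simp add: last_nonzero_def)
  qed
  then show thesis using that L j by auto
qed

lemma signed_revolving_digit:
  assumes \<delta>: "\<And>n. \<delta> (Suc n) = c * digit \<theta> \<omega> n" and "c \<noteq> 0"
  shows "signed_revolving \<theta> \<delta>"
  unfolding signed_revolving_def
proof (intro allI impI)
  fix k assume ex: "\<exists>j\<in>{1..k}. \<delta> j \<noteq> 0"
  then obtain j where j: "last_nonzero \<delta> k = Suc j" "j < k" "\<delta> (Suc j) \<noteq> 0"
    "\<And>i. j < i \<Longrightarrow> i < k \<Longrightarrow> \<delta> (Suc i) = 0"
    using last_nonzero_eq_Suc [OF ex] by metis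
  have "phase \<theta> \<omega> k = turn \<theta> j * phase \<theta> \<omega> j"
    using j \<open>c \<noteq> 0\<close> by (intro phase_jump) (auto simp: \<delta>)
  then have "\<delta> (k + 1) = 0 \<or> \<delta> (k + 1) = turn \<theta> j * \<delta> (Suc j)"
    using j(3) by (auto simp: \<delta> digit_def)
  then show "\<delta> (k + 1) = 0 \<or>
      (if odd (last_nonzero \<delta> k)
       then \<delta> (k + 1) = cis \<theta> * \<delta> (last_nonzero \<delta> k)
       else \<delta> (k + 1) = cis (- \<theta>) * \<delta> (last_nonzero \<delta> k))"
    by (simp add: j(1) turn_def split: if_splits)
qed

text \<open>The rule leaves no choice in the nonzero digits once the first one is known; its value is
  the rotation \<open>c\<close>, since the phase is \<open>1\<close> up to the first set bit.\<close>

lemma signed_revolving_imp_digit: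
  assumes rev: "signed_revolving \<theta> \<delta>"
    and first: "\<And>n. \<delta> (Suc n) \<noteq> 0 \<Longrightarrow> (\<And>i. i < n \<Longrightarrow> \<delta> (Suc i) = 0) \<Longrightarrow> \<delta> (Suc n) = c"
  shows "\<delta> (Suc n) = c * digit \<theta> (\<lambda>n. \<delta> (Suc n) \<noteq> 0) n"
proof (induction n rule: less_induct)
  case (less n)
  let ?\<omega> = "\<lambda>n. \<delta> (Suc n) \<noteq> 0"
  show ?case
  proof (cases "\<delta> (Suc n) = 0")
    case True
    then show ?thesis by (simp add: digit_def)
  next
    case nz: False
    show ?thesis
    proof (cases "\<exists>j\<in>{1..n}. \<delta> j \<noteq> 0")
      case False
      then have zero: "\<delta> (Suc i) = 0" if "i < n" for i
        using that by auto
      then have "phase \<theta> ?\<omega> n = 1" by (intro phase_eq_1) simp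
      then show ?thesis using first [OF nz zero] nz by (simp add: digit_def)
    next
      case True
      then obtain j where j: "last_nonzero \<delta> n = Suc j" "j < n" "\<delta> (Suc j) \<noteq> 0"
        "\<And>i. j < i \<Longrightarrow> i < n \<Longrightarrow> \<delta> (Suc i) = 0"
        using last_nonzero_eq_Suc [OF True] by metis
      have "\<delta> (Suc n) = turn \<theta> j * \<delta> (Suc j)"
      proof -
        have "n \<ge> 1" using j(2) by simp
        then have "\<delta> (n + 1) = 0 \<or>
            (if odd (Suc j) then \<delta> (n + 1) = cis \<theta> * \<delta> (Suc j)
             else \<delta> (n + 1) = cis (- \<theta>) * \<delta> (Suc j))"
          using rev True unfolding signed_revolving_def j(1) [symmetric] by blast
        then show ?thesis using nz by (simp add: turn_def split: if_splits)
      qed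
      also have "\<delta> (Suc j) = c * phase \<theta> ?\<omega> j"
        using less.IH [OF j(2)] j(3) by (simp add: digit_def)
      also have "turn \<theta> j * (c * phase \<theta> ?\<omega> j) = c * phase \<theta> ?\<omega> n"
        using phase_jump [of j n ?\<omega> \<theta>] j by simp
      finally show ?thesis using nz by (simp add: digit_def)
    qed
  qed
qed

lemma Delta_eq_powers: "Delta p \<theta> = insert 0 {cis \<theta> ^ k | k. k < p}"
  unfolding Delta_def Complex.DeMoivre ..

lemma power_mod_root_of_unity:
  fixes u :: complex
  assumes "u ^ p = 1"
  shows "u ^ (m mod p) = u ^ m"
proof -
  have "u ^ m = u ^ (p * (m div p) + m mod p)" by simp
  also have "\<dots> = u ^ (m mod p)"
    using assms by (simp only: power_add power_mult power_one mult_1_left)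
  finally show ?thesis by simp
qed

lemma phase_eq_power:
  assumes "cis \<theta> ^ p = 1" "p \<ge> 1"
  shows "\<exists>m. phase \<theta> \<omega> n = cis \<theta> ^ m"
proof (induction n)
  case 0
  show ?case by (rule exI [of _ 0]) (simp add: phase_def)
next
  case (Suc n)
  have "cis \<theta> * cis \<theta> ^ (p - 1) = 1"
    using assms by (metis power_eq_if not_one_le_zero)
  then have inv: "cis (- \<theta>) = cis \<theta> ^ (p - 1)"
    by (metis cis_inverse inverse_unique)
  \<comment> \<open>The inverse turn is a natural power because \<open>cis \<theta>\<close> has finite order.\<close>
  have "\<exists>r. (if \<omega> n then turn \<theta> n else 1) = cis \<theta> ^ r"
    unfolding turn_def inv by (metis power_0 power_one_right)
  then obtain r where "(if \<omega> n then turn \<theta> n else 1) = cis \<theta> ^ r" ..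
  moreover obtain m where "phase \<theta> \<omega> n = cis \<theta> ^ m" using Suc ..
  ultimately have "phase \<theta> \<omega> (Suc n) = cis \<theta> ^ (m + r)"
    by (simp add: phase_def power_add)
  then show ?case ..
qed

text \<open>Membership in \<open>Delta\<close> uses the root of unity twice: it turns every digit into a power of
  \<open>cis \<theta>\<close>, and it reduces the exponent below \<open>p\<close>.\<close>

lemma W_signed_iff:
  assumes root: "cis \<theta> ^ p = 1" and p: "p \<ge> 1"
  shows "\<delta> \<in> W_signed p \<theta> \<longleftrightarrow> (\<exists>k<p. \<exists>\<omega>. \<forall>n. \<delta> (Suc n) = cis \<theta> ^ k * digit \<theta> \<omega> n)"
proof
  assume W: "\<delta> \<in> W_signed p \<theta>"
  obtain k where k: "k < p"
    "\<And>n. \<delta> (Suc n) \<noteq> 0 \<Longrightarrow> (\<And>i. i < n \<Longrightarrow> \<delta> (Suc i) = 0) \<Longrightarrow> \<delta> (Suc n) = cis \<theta> ^ k"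
  proof (cases "\<exists>n. \<delta> (Suc n) \<noteq> 0")
    case False
    \<comment> \<open>Every rotation fixes the zero sequence.\<close>
    then show thesis using that [of 0] p by auto
  next
    case True
    define m where "m = (LEAST n. \<delta> (Suc n) \<noteq> 0)"
    have m: "\<delta> (Suc m) \<noteq> 0"
      using True unfolding m_def by (rule LeastI_ex)
    have "\<delta> (Suc m) \<in> Delta p \<theta>"
      using W by (auto simp: W_signed_def)
    then obtain k where "k < p" "\<delta> (Suc m) = cis \<theta> ^ k"
      using m by (auto simp: Delta_eq_powers)
    moreover have "n = m" if "\<delta> (Suc n) \<noteq> 0" "\<And>i. i < n \<Longrightarrow> \<delta> (Suc i) = 0" for n
    proof (rule antisym)
      show "n \<le> m" using that(2) m by (meson not_less)
      show "m \<le> n" unfolding m_def using that(1) by (rule Least_le)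
    qed
    ultimately show thesis using that by metis
  qed
  have "signed_revolving \<theta> \<delta>" using W by (simp add: W_signed_def)
  from signed_revolving_imp_digit [OF this k(2)] k(1)
  show "\<exists>k<p. \<exists>\<omega>. \<forall>n. \<delta> (Suc n) = cis \<theta> ^ k * digit \<theta> \<omega> n" by blast
next
  assume "\<exists>k<p. \<exists>\<omega>. \<forall>n. \<delta> (Suc n) = cis \<theta> ^ k * digit \<theta> \<omega> n"
  then obtain k \<omega> where \<delta>: "\<And>n. \<delta> (Suc n) = cis \<theta> ^ k * digit \<theta> \<omega> n" by blast
  have "\<delta> (Suc n) \<in> Delta p \<theta>" for n
  proof (cases "\<omega> n")
    case True
    obtain m where "phase \<theta> \<omega> n = cis \<theta> ^ m"
      using phase_eq_power [OF root p] by blast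
    then have "\<delta> (Suc n) = cis \<theta> ^ ((k + m) mod p)"
      using True by (simp add: \<delta> digit_def power_add power_mod_root_of_unity [OF root])
    then show ?thesis using p by (auto simp: Delta_eq_powers)
  qed (simp add: \<delta> Delta_def digit_def)
  then have "\<delta> n \<in> Delta p \<theta>" if "n \<ge> 1" for n
    using that by (cases n) auto
  then have "\<delta> \<in> {1..} \<rightarrow> Delta p \<theta>" by simp
  moreover have "signed_revolving \<theta> \<delta>"
    by (rule signed_revolving_digit [OF \<delta>]) simp
  ultimately show "\<delta> \<in> W_signed p \<theta>" by (simp add: W_signed_def)
qed

theorem theorem2p5:
  fixes \<alpha> :: complex and \<theta> :: real and p q :: nat
  assumes "norm \<alpha> < 1"
    and "- pi < \<theta>" and "\<theta> \<le> pi"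
    and "p \<ge> 1"
    and "\<bar>\<theta>\<bar> = 2 * pi * real q / real p"
  shows "(\<Union>k\<in>{0..p-1}. (\<lambda>z. cis \<theta> ^ k * z) ` K2 \<alpha> \<theta>) = X2 p \<alpha> \<theta>"
proof -
  have "cis \<bar>\<theta>\<bar> ^ p = cis (2 * pi * real q)"
    unfolding Complex.DeMoivre using assms(4,5) by simp
  also have "\<dots> = 1" by (rule cis_multiple_2pi) simp
  finally have "cis \<bar>\<theta>\<bar> ^ p = 1" .
  then have root: "cis \<theta> ^ p = 1"
    by (cases "\<theta> \<ge> 0") (auto simp: cis_inverse [symmetric] power_inverse simp del: cis_inverse)
  have rot: "(\<Sum>n. (cis \<theta> ^ k * digit \<theta> \<omega> n) * weight \<alpha> (Suc n)) = cis \<theta> ^ k * address \<alpha> \<theta> \<omega>" for k \<omega>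
    unfolding address_def mult.assoc by (rule suminf_mult [OF summable_address [OF assms(1)]])
  have "x \<in> X2 p \<alpha> \<theta> \<longleftrightarrow> (\<exists>k<p. \<exists>\<omega>. x = cis \<theta> ^ k * address \<alpha> \<theta> \<omega>)" for x
  proof
    assume "x \<in> X2 p \<alpha> \<theta>"
    then show "\<exists>k<p. \<exists>\<omega>. x = cis \<theta> ^ k * address \<alpha> \<theta> \<omega>"
      unfolding X2_def W_signed_iff [OF root assms(4)] weight_def [symmetric] using rot by force
  next
    assume "\<exists>k<p. \<exists>\<omega>. x = cis \<theta> ^ k * address \<alpha> \<theta> \<omega>"
    then obtain k \<omega> where k: "k < p" "x = cis \<theta> ^ k * address \<alpha> \<theta> \<omega>" by blast
    define \<delta> where "\<delta> = case_nat 0 (\<lambda>n. cis \<theta> ^ k * digit \<theta> \<omega> n)"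
    have \<delta>: "\<delta> (Suc n) = cis \<theta> ^ k * digit \<theta> \<omega> n" for n by (simp add: \<delta>_def)
    have "\<delta> \<in> W_signed p \<theta>"
      unfolding W_signed_iff [OF root assms(4)] using k(1) \<delta> by blast
    moreover have "x = (\<Sum>n. \<delta> (Suc n) * weight \<alpha> (Suc n))"
      by (simp add: \<delta> rot k(2))
    ultimately show "x \<in> X2 p \<alpha> \<theta>"
      unfolding X2_def weight_def by blast
  qed
  then have "X2 p \<alpha> \<theta> = (\<Union>k\<in>{..<p}. (\<lambda>z. cis \<theta> ^ k * z) ` range (address \<alpha> \<theta>))"
    by (intro set_eqI, simp only: UN_iff, auto)
  moreover have "{0..p - 1} = {..<p}"
    using assms(4) by auto
  ultimately show ?thesis
    by (simp only: K2_eq_range_address [OF assms(1)])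
qed

end
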